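(* Suppose we are given a set of points $Y\subseteq\mathbb{R}^d$ with $|Y|=n$, and $0\le\delta\le1$, $0\le\gamma\le1$, such that there exists a subset $Y^\star\subseteq Y$ with $|Y^\star|\ge\delta|Y|$ that is contained in an unknown ball $B^\star=B(c^\star,R^\star)$. Then one can find (algorithmically, from $Y,\delta,\gamma$) an ellipsoid $\widehat{E}$ such that $|\widehat{E}\cap Y|\ge\delta(1-\gamma)|Y|$ and $$\mathrm{vol}(\widehat{E})^{1/d}\le\mathrm{vol}(B^\star)^{1/d}\cdot\left(1+O\left(d^{-1/2+o(1)}/(\gamma\delta)\right)\right).$$
   Context: $B(c,R)=\{y\in\mathbb{R}^d:\|y-c\|_2\le R\}$; an ellipsoid is a set of the form $\{c+Au:\|u\|_2\le 1\}$ for $c\in\mathbb{R}^d$ and a $d\times d$ matrix $A$; $\mathrm{vol}$ is Lebesgue measure. *)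

theory Defs
  imports "HOL-Analysis.Analysis"
begin

text \<open>
  The asymptotic constants are uniform in the dimension \<open>d\<close>, so \<open>d\<close> is a term and not a type:
  a vector of \<open>\<real>\<^sup>d\<close> is an extensional function on \<open>{..<d}\<close>.
\<close>

definition Rd :: "nat \<Rightarrow> (nat \<Rightarrow> real) set" where
  "Rd d = ({..<d} \<rightarrow>\<^sub>E UNIV)"

definition ball2 :: "nat \<Rightarrow> (nat \<Rightarrow> real) \<Rightarrow> real \<Rightarrow> (nat \<Rightarrow> real) set" where
  "ball2 d c R = {y \<in> Rd d. L2_set (\<lambda>i. y i - c i) {..<d} \<le> R}"

definition ellipsoid ::
  "nat \<Rightarrow> (nat \<Rightarrow> real) \<Rightarrow> (nat \<Rightarrow> nat \<Rightarrow> real) \<Rightarrow> (nat \<Rightarrow> real) set" where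
  "ellipsoid d c A =
     (\<lambda>u. \<lambda>i\<in>{..<d}. c i + (\<Sum>j<d. A i j * u j)) ` {u \<in> Rd d. L2_set u {..<d} \<le> 1}"

text \<open>
  Only applied to compact sets, on which the Borel product measure is Lebesgue measure and is
  finite.
\<close>

definition vol :: "nat \<Rightarrow> (nat \<Rightarrow> real) set \<Rightarrow> real" where
  "vol d S = measure (Pi\<^sub>M {..<d} (\<lambda>_. lborel)) S"


text \<open>
  Algorithms on exact real data are programs of a real RAM. A store has one array of natural
  numbers and one array of reals; addresses are natural numbers, so they can be computed but never
  obtained by rounding a real. Reals admit field operations and comparisons only, there are no real
  constants besides the natural numbers, and no root extraction. Subtraction of natural numbers is
  truncated, and division by zero yields zero, which a program could also arrange by a test.
\<close>

type_synonym store = "(nat \<Rightarrow> nat) \<times> (nat \<Rightarrow> real)"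

datatype nexp =
    NLit nat
  | NCell nexp
  | NPlus nexp nexp
  | NMinus nexp nexp
  | NTimes nexp nexp

datatype rexp =
    ROfNat nexp
  | RCell nexp
  | RPlus rexp rexp
  | RMinus rexp rexp
  | RTimes rexp rexp
  | RDivide rexp rexp

datatype bexp =
    NLess nexp nexp
  | RLess rexp rexp
  | Neg bexp
  | Conj bexp bexp

datatype com =
    Skip
  | NAssign nexp nexp
  | RAssign nexp rexp
  | Seq com com
  | Cond bexp com com
  | While bexp com

primrec nval :: "nexp \<Rightarrow> store \<Rightarrow> nat" where
  "nval (NLit k) s = k"
| "nval (NCell a) s = fst s (nval a s)"
| "nval (NPlus a b) s = nval a s + nval b s"
| "nval (NMinus a b) s = nval a s - nval b s"
| "nval (NTimes a b) s = nval a s * nval b s"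

primrec rval :: "rexp \<Rightarrow> store \<Rightarrow> real" where
  "rval (ROfNat a) s = real (nval a s)"
| "rval (RCell a) s = snd s (nval a s)"
| "rval (RPlus a b) s = rval a s + rval b s"
| "rval (RMinus a b) s = rval a s - rval b s"
| "rval (RTimes a b) s = rval a s * rval b s"
| "rval (RDivide a b) s = rval a s / rval b s"

primrec bval :: "bexp \<Rightarrow> store \<Rightarrow> bool" where
  "bval (NLess a b) s = (nval a s < nval b s)"
| "bval (RLess a b) s = (rval a s < rval b s)"
| "bval (Neg b) s = (\<not> bval b s)"
| "bval (Conj a b) s = (bval a s \<and> bval b s)"

text \<open>
  \<open>exec p s t\<close>: started in \<open>s\<close>, the program \<open>p\<close> halts, and it does so in \<open>t\<close>. The first argument of
  an assignment is the address of the cell written to.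
\<close>

inductive exec :: "com \<Rightarrow> store \<Rightarrow> store \<Rightarrow> bool" where
  Skip: "exec Skip s s"
| NAssign: "exec (NAssign a e) s ((fst s)(nval a s := nval e s), snd s)"
| RAssign: "exec (RAssign a e) s (fst s, (snd s)(nval a s := rval e s))"
| Seq: "exec p s t \<Longrightarrow> exec q t u \<Longrightarrow> exec (Seq p q) s u"
| CondTrue: "bval b s \<Longrightarrow> exec p s t \<Longrightarrow> exec (Cond b p q) s t"
| CondFalse: "\<not> bval b s \<Longrightarrow> exec q s t \<Longrightarrow> exec (Cond b p q) s t"
| WhileFalse: "\<not> bval b s \<Longrightarrow> exec (While b p) s s"
| WhileTrue: "bval b s \<Longrightarrow> exec p s t \<Longrightarrow> exec (While b p) t u \<Longrightarrow> exec (While b p) s u"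

inductive_cases exec_SkipE: "exec Skip s t"
inductive_cases exec_NAssignE: "exec (NAssign a e) s t"
inductive_cases exec_RAssignE: "exec (RAssign a e) s t"
inductive_cases exec_SeqE: "exec (Seq p q) s t"
inductive_cases exec_CondE: "exec (Cond b p q) s t"
inductive_cases exec_WhileE: "exec (While b p) s t"

lemma exec_deterministic: "exec p s t \<Longrightarrow> exec p s t' \<Longrightarrow> t' = t"
proof (induction arbitrary: t' rule: exec.induct)
  case Skip
  then show ?case by (rule exec_SkipE) simp
next
  case NAssign
  then show ?case by (rule exec_NAssignE) simp
next
  case RAssign
  then show ?case by (rule exec_RAssignE) simp
next
  case (Seq p s t q u)
  from Seq.prems show ?case by (rule exec_SeqE) (use Seq.IH in blast)
next
  case (CondTrue b s p t q)
  from CondTrue.prems show ?case by (rule exec_CondE) (use CondTrue in blast)+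
next
  case (CondFalse b s q t p)
  from CondFalse.prems show ?case by (rule exec_CondE) (use CondFalse in blast)+
next
  case (WhileFalse b s p)
  from WhileFalse.prems show ?case by (rule exec_WhileE) (use WhileFalse in simp_all)
next
  case (WhileTrue b s p t u)
  from WhileTrue.prems show ?case
  proof (rule exec_WhileE)
    assume "\<not> bval b s"
    then show ?thesis using WhileTrue.hyps by blast
  next
    fix r assume "exec p s r" "exec (While b p) r t'"
    then show ?thesis using WhileTrue.IH by blast
  qed
qed

text \<open>
  Input: the naturals are \<open>d\<close>, the number of points, and then zeros; the reals are \<open>\<delta>\<close>, \<open>\<gamma>\<close>, the
  coordinates of the points, point by point, and then zeros. A finite set of points is presented to
  a program as a list enumerating it.
\<close>

definition input_store :: "nat \<Rightarrow> (nat \<Rightarrow> real) list \<Rightarrow> real \<Rightarrow> real \<Rightarrow> store" where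
  "input_store d ys \<delta> \<gamma> =
     (\<lambda>k. if k = 0 then d else if k = 1 then length ys else 0,
      \<lambda>k. if k = 0 then \<delta> else if k = 1 then \<gamma>
          else if k - 2 < length ys * d then (ys ! ((k - 2) div d)) ((k - 2) mod d) else 0)"

text \<open>Output: the centre, followed by the matrix, row by row, at the start of the real array.\<close>

definition output_ellipsoid :: "nat \<Rightarrow> store \<Rightarrow> (nat \<Rightarrow> real) set" where
  "output_ellipsoid d t = ellipsoid d (\<lambda>i\<in>{..<d}. snd t i) (\<lambda>i j. snd t (d + i * d + j))"

end

theory Submission
  imports Defs
begin

text \<open>
  Since the running time is unrestricted, exhaustive search suffices, provided that some candidate
  centre is good. Fix a ball of centre \<open>z\<close> and radius \<open>R\<close> around \<open>Y\<^sup>\<star>\<close>, start at a point of \<open>Y\<^sup>\<star>\<close>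
  and repeatedly move the current centre \<open>c\<close> the fraction \<open>1 / (d + 1)\<close> of the way to a point \<open>p\<close> of
  \<open>Y\<^sup>\<star>\<close> at distance more than \<open>(1 + 1 / d) R\<close> from \<open>c\<close>. Each such move lowers \<open>\<parallel>c - z\<parallel>\<^sup>2\<close> by at least
  \<open>R\<^sup>2 / (d (d + 1))\<close>, so after at most \<open>d (d + 1)\<close> moves all of \<open>Y\<^sup>\<star>\<close> lies within \<open>(1 + 1 / d) R\<close> of
  \<open>c\<close>. The program generates every centre reachable by that many moves towards arbitrary points of
  \<open>Y\<close>, takes the smallest ball around one of them that contains \<open>\<delta> |Y|\<close> points, and
  replaces its radius, a square root, by a Newton approximation from above with relative error at
  most \<open>1 / d\<close>. The radius exceeds \<open>R\<close> by a factor of at most \<open>(1 + 1 / d)\<^sup>2 \<le> 1 + 3 / d\<close>.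
\<close>

section \<open>Balls and scalar ellipsoids\<close>

text \<open>Translating a coordinate preserves \<open>lborel\<close>, and a product measure is
  determined by its values on boxes. This reduces ball volumes to centre 0, where
  \<open>emeasure_cball_aux\<close> applies.\<close>

lemma vol_ball2_translate:
  "vol d (ball2 d c R) = vol d (ball2 d (\<lambda>_. 0) R)"
proof -
  interpret product_sigma_finite "\<lambda>_::nat. lborel :: real measure" by standard
  let ?P = "Pi\<^sub>M {..<d} (\<lambda>_. lborel :: real measure)"
  define T where "T = (\<lambda>x. \<lambda>i\<in>{..<d}. c i + (x i :: real))"
  have T: "T \<in> measurable ?P ?P"
    unfolding T_def by measurable
  have ball: "ball2 d c' R \<in> sets ?P" for c'
  proof -
    have "{y \<in> space ?P. L2_set (\<lambda>i. y i - c' i) {..<d} \<le> R} \<in> sets ?P"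
      unfolding L2_set_def by measurable
    then show ?thesis by (simp add: ball2_def Rd_def space_PiM)
  qed
  have "distr ?P ?P T = ?P"
  proof (rule PiM_eqI)
    fix S :: "nat \<Rightarrow> real set"
    assume S: "\<And>i. i \<in> {..<d} \<Longrightarrow> S i \<in> sets lborel"
    have shift: "(\<lambda>x. c i + x) -` S i \<in> sets lborel" if "i < d" for i
      using measurable_sets[OF _ S, of "(+) (c i)" lborel i] that by simp
    have "emeasure (distr ?P ?P T) (Pi\<^sub>E {..<d} S) = emeasure ?P (T -` Pi\<^sub>E {..<d} S \<inter> space ?P)"
      using S by (intro emeasure_distr T sets_PiM_I_finite) auto
    also have "T -` Pi\<^sub>E {..<d} S \<inter> space ?P = (\<Pi>\<^sub>E i\<in>{..<d}. (\<lambda>x. c i + x) -` S i)"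
      by (auto simp: T_def space_PiM PiE_iff)
    also have "emeasure ?P \<dots> = (\<Prod>i<d. emeasure lborel ((\<lambda>x. c i + x) -` S i))"
      using shift by (intro emeasure_PiM) auto
    also have "\<dots> = (\<Prod>i<d. emeasure lborel (S i))"
    proof (rule prod.cong)
      fix i assume "i \<in> {..<d}"
      then have "emeasure (distr lborel borel ((+) (c i))) (S i)
          = emeasure lborel ((\<lambda>x. c i + x) -` S i)"
        using S by (subst emeasure_distr) auto
      then show "emeasure lborel ((\<lambda>x. c i + x) -` S i) = emeasure lborel (S i)"
        by (simp add: lborel_distr_plus)
    qed simp
    finally show "emeasure (distr ?P ?P T) (Pi\<^sub>E {..<d} S) = (\<Prod>i<d. emeasure lborel (S i))" .
  qed auto
  then have "measure ?P (ball2 d c R) = measure (distr ?P ?P T) (ball2 d c R)"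
    by simp
  also have "\<dots> = measure ?P (T -` ball2 d c R \<inter> space ?P)"
    by (intro measure_distr T ball)
  also have "T -` ball2 d c R \<inter> space ?P = ball2 d (\<lambda>_. 0) R"
  proof -
    have "L2_set (\<lambda>i. T x i - c i) {..<d} = L2_set (\<lambda>i. x i - 0) {..<d}" for x
      by (intro L2_set_cong) (auto simp: T_def)
    moreover have "T x \<in> Rd d" for x
      by (simp add: T_def Rd_def)
    ultimately show ?thesis
      by (auto simp: ball2_def space_PiM Rd_def)
  qed
  finally show ?thesis
    by (simp add: vol_def)
qed

text \<open>Radius 0 is treated apart because \<open>emeasure_cball_aux\<close> is used with
  \<open>R > 0\<close>; the ball is then a product of singletons, a null set since
  \<open>d \<ge> 1\<close>.\<close>

lemma vol_ball2:
  assumes "d \<ge> 1" "R \<ge> 0"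
  shows "vol d (ball2 d c R) = unit_ball_vol (real d) * R ^ d"
proof (cases "R = 0")
  case True
  interpret product_sigma_finite "\<lambda>_::nat. lborel :: real measure" by standard
  have "ball2 d (\<lambda>_. 0) 0 = (\<Pi>\<^sub>E i\<in>{..<d}. {0})"
  proof -
    have "L2_set f {..<d} \<le> 0 \<longleftrightarrow> (\<forall>i<d. f i = 0)" for f :: "nat \<Rightarrow> real"
    proof -
      have "L2_set f {..<d} \<le> 0 \<longleftrightarrow> L2_set f {..<d} = 0"
        using L2_set_nonneg[of f "{..<d}"] by linarith
      then show ?thesis by (simp add: L2_set_eq_0_iff Ball_def)
    qed
    then show ?thesis
      by (auto simp: ball2_def Rd_def PiE_iff fun_eq_iff extensional_def)
  qed
  moreover have "emeasure (Pi\<^sub>M {..<d} (\<lambda>_. lborel)) (\<Pi>\<^sub>E i\<in>{..<d}. {0::real}) = 0"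
    using assms by (subst emeasure_PiM) auto
  ultimately show ?thesis
    using True assms by (subst vol_ball2_translate) (simp add: vol_def measure_def)
next
  case False
  then have R: "R > 0" using assms by simp
  have "ball2 d (\<lambda>_. 0) R
      = {f. sqrt (\<Sum>i\<in>{..<d}. (f i)\<^sup>2) \<le> R} \<inter> space (Pi\<^sub>M {..<d} (\<lambda>_. lborel))"
    by (auto simp: ball2_def Rd_def space_PiM L2_set_def)
  then have "emeasure (Pi\<^sub>M {..<d} (\<lambda>_. lborel)) (ball2 d (\<lambda>_. 0) R)
      = ennreal (unit_ball_vol (real d) * R ^ d)"
    using emeasure_cball_aux[of "{..<d}" R] R by simp
  then show ?thesis
    using R by (subst vol_ball2_translate) (simp add: vol_def measure_def)
qed

text \<open>After the \<open>d\<close>-th root the volume is linear in the radius, so the volume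
  bound reduces to a comparison of radii.\<close>

lemma vol_ball2_root:
  assumes "d \<ge> 1" "R \<ge> 0"
  shows "vol d (ball2 d c R) powr (1 / real d) = unit_ball_vol (real d) powr (1 / real d) * R"
proof -
  have "(R ^ d) powr (1 / real d) = R"
    using assms by (cases "R = 0") (auto simp flip: powr_realpow simp: powr_powr)
  then show ?thesis
    using assms by (simp add: vol_ball2 powr_mult)
qed

text \<open>Makes a ball an admissible output. Radius 0 has to be included: it occurs for empty
  input, and when a single point already suffices.\<close>

lemma ellipsoid_scalar:
  assumes "\<And>i j. i < d \<Longrightarrow> j < d \<Longrightarrow> A i j = (if i = j then \<rho> else 0)" and "\<rho> \<ge> 0"
  shows "ellipsoid d c A = ball2 d c \<rho>"
proof -
  have mult: "(\<Sum>j<d. A i j * u j) = \<rho> * u i" if "i < d" for i u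
  proof -
    have "(\<Sum>j<d. A i j * u j) = (\<Sum>j<d. if j = i then \<rho> * u i else 0)"
      using that assms(1) by (intro sum.cong) auto
    then show ?thesis using that by simp
  qed
  have "ellipsoid d c A = (\<lambda>u. \<lambda>i\<in>{..<d}. c i + \<rho> * u i) ` {u \<in> Rd d. L2_set u {..<d} \<le> 1}"
    unfolding ellipsoid_def by (intro image_cong refl restrict_ext) (simp add: mult)
  also have "\<dots> = ball2 d c \<rho>"
  proof (intro subset_antisym subsetI)
    fix y assume "y \<in> (\<lambda>u. \<lambda>i\<in>{..<d}. c i + \<rho> * u i) ` {u \<in> Rd d. L2_set u {..<d} \<le> 1}"
    then obtain u where u: "u \<in> Rd d" "L2_set u {..<d} \<le> 1"
        "y = (\<lambda>i\<in>{..<d}. c i + \<rho> * u i)" by blast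
    have "L2_set (\<lambda>i. y i - c i) {..<d} = L2_set (\<lambda>i. \<rho> * u i) {..<d}"
      using u by (intro L2_set_cong) auto
    also have "\<dots> = \<rho> * L2_set u {..<d}"
      using assms(2) by (simp add: L2_set_right_distrib)
    also have "\<dots> \<le> \<rho>"
      using mult_left_mono[OF u(2) assms(2)] by simp
    finally show "y \<in> ball2 d c \<rho>"
      using u by (simp add: ball2_def Rd_def)
  next
    fix y assume "y \<in> ball2 d c \<rho>"
    then have y: "y \<in> Rd d" "L2_set (\<lambda>i. y i - c i) {..<d} \<le> \<rho>"
      by (auto simp: ball2_def)
    \<comment> \<open>For \<open>\<rho> = 0\<close> the convention \<open>inverse 0 = 0\<close>
      makes \<open>u\<close> the origin, which is a valid preimage of the only point of the
      ball.\<close>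
    define u where "u = (\<lambda>i\<in>{..<d}. inverse \<rho> * (y i - c i))"
    have "L2_set u {..<d} = L2_set (\<lambda>i. inverse \<rho> * (y i - c i)) {..<d}"
      unfolding u_def by (intro L2_set_cong) auto
    also have "\<dots> = inverse \<rho> * L2_set (\<lambda>i. y i - c i) {..<d}"
      using assms(2) by (simp add: L2_set_right_distrib)
    also have "\<dots> \<le> 1"
      using y(2) assms(2) by (cases "\<rho> = 0") (auto simp: field_simps)
    finally have "u \<in> {u \<in> Rd d. L2_set u {..<d} \<le> 1}"
      by (simp add: u_def Rd_def)
    moreover have "y = (\<lambda>i\<in>{..<d}. c i + \<rho> * u i)"
    proof (cases "\<rho> = 0")
      case True
      have "L2_set (\<lambda>i. y i - c i) {..<d} = 0"
        using y(2) True by (intro order.antisym) auto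
      then show ?thesis
        using y(1) True by (auto simp: Rd_def PiE_iff extensional_def restrict_def L2_set_eq_0_iff)
    next
      case False
      then show ?thesis
        using y(1) by (auto simp: Rd_def u_def PiE_iff extensional_def restrict_def fun_eq_iff simp flip: mult.assoc)
    qed
    ultimately show "y \<in> (\<lambda>u. \<lambda>i\<in>{..<d}. c i + \<rho> * u i) ` {u \<in> Rd d. L2_set u {..<d} \<le> 1}"
      by blast
  qed
  finally show ?thesis .
qed

section \<open>The forest of candidate centres\<close>

definition sqdist :: "nat \<Rightarrow> (nat \<Rightarrow> real) \<Rightarrow> (nat \<Rightarrow> real) \<Rightarrow> real" where
  "sqdist d x y = (\<Sum>i<d. (x i - y i)\<^sup>2)"

lemma sqdist_nonneg: "sqdist d x y \<ge> 0"
  by (simp add: sqdist_def sum_nonneg)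

lemma sqdist_eq_0_iff: "sqdist d x y = 0 \<longleftrightarrow> (\<forall>i<d. x i = y i)"
  by (simp add: sqdist_def sum_nonneg_eq_0_iff) auto

lemma sqdist_cong: "(\<And>i. i < d \<Longrightarrow> x i = x' i) \<Longrightarrow> (\<And>i. i < d \<Longrightarrow> y i = y' i)
    \<Longrightarrow> sqdist d x y = sqdist d x' y'"
  by (simp add: sqdist_def)

lemma sqdist_commute: "sqdist d x y = sqdist d y x"
  by (simp add: sqdist_def power2_commute)

lemma in_ball2_iff:
  assumes "y \<in> Rd d" "R \<ge> 0"
  shows "y \<in> ball2 d c R \<longleftrightarrow> sqdist d c y \<le> R\<^sup>2"
proof -
  have "L2_set (\<lambda>i. y i - c i) {..<d} = sqrt (sqdist d c y)"
    by (simp add: L2_set_def sqdist_def power2_commute)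
  then show ?thesis
    using assms by (simp add: ball2_def real_le_lsqrt real_sqrt_le_iff' sqdist_nonneg)
qed

text \<open>Stewart's identity for the affine combination \<open>w c + (1 - w) p\<close>, expanded
  coordinate by coordinate.\<close>

lemma sqdist_step:
  assumes "\<And>i. i < d \<Longrightarrow> c' i = p i + w * (c i - p i)"
  shows "sqdist d c' z = w * sqdist d c z + (1 - w) * sqdist d p z - w * (1 - w) * sqdist d c p"
proof -
  have "sqdist d c' z = (\<Sum>i<d. w * (c i - z i)\<^sup>2 + (1 - w) * (p i - z i)\<^sup>2 - w * (1 - w) * (c i - p i)\<^sup>2)"
    unfolding sqdist_def
    by (intro sum.cong refl) (simp add: assms power2_eq_square algebra_simps)
  then show ?thesis
    by (simp add: sqdist_def sum.distrib sum_subtractf sum_distrib_left)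
qed

text \<open>In Stewart's identity the term in \<open>p\<close> and \<open>z\<close> costs at most
  \<open>(1 - w) r\<close>, while the large distance from \<open>c\<close> to \<open>p\<close> gains
  more than that; the difference is the decrease.\<close>

lemma sqdist_decrease:
  assumes "d \<ge> 1" "sqdist d p z \<le> r" "r \<ge> 0" "r * (1 + 1 / real d)\<^sup>2 \<le> sqdist d c p"
    and "\<And>i. i < d \<Longrightarrow> c' i = p i + real d / (real d + 1) * (c i - p i)"
  shows "sqdist d c' z \<le> sqdist d c z - r / (real d * (real d + 1))"
proof -
  define w where "w = real d / (real d + 1)"
  have d: "real d > 0" using assms by simp
  have w: "0 < w" "w < 1" using d by (auto simp: w_def)
  \<comment> \<open>Step length and distance threshold are matched: because this product is 1, the
    factor \<open>1 - w * (1 + 1 / real d)\<^sup>2\<close> below equals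
    \<open>- 1 / d\<close>.\<close>
  have "w * (1 + 1 / real d) = 1" using d by (simp add: w_def divide_simps)
  then have w1: "w * (1 + 1 / real d)\<^sup>2 = 1 + 1 / real d"
    unfolding power2_eq_square mult.assoc[symmetric] by simp
  have w2: "1 - w = 1 / (real d + 1)"
    using d by (simp add: w_def field_simps)
  have "sqdist d c' z = w * sqdist d c z + (1 - w) * sqdist d p z - w * (1 - w) * sqdist d c p"
    by (rule sqdist_step) (simp add: assms(5) w_def)
  also have "\<dots> \<le> 1 * sqdist d c z + (1 - w) * r - w * (1 - w) * (r * (1 + 1 / real d)\<^sup>2)"
    using assms w sqdist_nonneg[of d c z] by (intro add_mono diff_mono mult_left_mono mult_right_mono) auto
  also have "\<dots> = sqdist d c z + (1 - w) * r * (1 - w * (1 + 1 / real d)\<^sup>2)"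
    by (simp add: algebra_simps)
  also have "\<dots> = sqdist d c z - r / (real d * (real d + 1))"
    unfolding w1 w2 using d by (simp add: field_simps)
  finally show ?thesis .
qed

text \<open>
  The centres form a forest whose roots are the points \<open>0, \<dots>, n - 1\<close>; the \<open>j\<close>-th child of \<open>q\<close>, the
  move from \<open>q\<close> towards the point \<open>j\<close>, has number \<open>n + (q * n + j)\<close>. The centres reachable by \<open>t\<close>
  moves are numbered below \<open>node_count n t\<close>.
\<close>

primrec node_count :: "nat \<Rightarrow> nat \<Rightarrow> nat" where
  "node_count n 0 = n"
| "node_count n (Suc t) = n + n * node_count n t"

lemma node_count_mono: "t \<le> t' \<Longrightarrow> node_count n t \<le> node_count n t'"
proof -
  have "node_count n k \<le> node_count n (Suc k)" for k
    by (cases n; induction k) auto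
  then show "t \<le> t' \<Longrightarrow> node_count n t \<le> node_count n t'"
    by (rule lift_Suc_mono_le)
qed

text \<open>The squared distance to \<open>z\<close> is a potential. A centre that misses a point of
  \<open>J\<close> has a child whose potential bound is smaller by \<open>r / ?K\<close>, and
  \<open>?K\<close> moves use up the initial bound \<open>r\<close>. Since \<open>z\<close> occurs
  in the analysis only, it may be the unknown centre.\<close>

lemma near_center_exists:
  fixes x :: "nat \<Rightarrow> nat \<Rightarrow> real" and J :: "nat set"
  assumes d: "d \<ge> 1" and J: "J \<subseteq> {..<n}" "J \<noteq> {}" and r: "r \<ge> 0"
    and near: "\<And>j. j \<in> J \<Longrightarrow> sqdist d (x j) z \<le> r"
    and tree: "\<And>q j i. q < node_count n (d * d + d) \<Longrightarrow> j < n \<Longrightarrow> i < d \<Longrightarrow>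
       x (n + (q * n + j)) i = x j i + real d / (real d + 1) * (x q i - x j i)"
  shows "\<exists>q < node_count n (d * d + d). \<forall>j\<in>J. sqdist d (x q) (x j) \<le> r * (1 + 1 / real d)\<^sup>2"
proof (rule ccontr)
  let ?K = "d * d + d"
  assume neg: "\<not> ?thesis"
  have d0: "real d > 0" using d by simp
  have K: "real ?K = real d * (real d + 1)" by (simp add: algebra_simps)
  have step: "\<exists>q < node_count n t. sqdist d (x q) z \<le> r - real t * (r / real ?K)" if "t \<le> ?K" for t
    using that
  proof (induction t)
    case 0
    then show ?case using J near by fastforce
  next
    case (Suc t)
    then obtain q where q: "q < node_count n t" "sqdist d (x q) z \<le> r - real t * (r / real ?K)"
      by auto
    then have qK: "q < node_count n ?K"
      using node_count_mono[of t ?K n] Suc.prems by linarith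
    with neg obtain j where j: "j \<in> J" "r * (1 + 1 / real d)\<^sup>2 \<le> sqdist d (x q) (x j)"
      by (meson linear)
    have jn: "j < n" using j J by auto
    have "sqdist d (x (n + (q * n + j))) z \<le> sqdist d (x q) z - r / (real d * (real d + 1))"
      using tree[OF qK jn] near[OF j(1)] j(2) r d by (intro sqdist_decrease) auto
    also have "\<dots> \<le> r - real (Suc t) * (r / real ?K)"
      using q(2) unfolding K of_nat_Suc distrib_right by simp
    finally have "sqdist d (x (n + (q * n + j))) z \<le> r - real (Suc t) * (r / real ?K)" .
    moreover have "n + (q * n + j) < node_count n (Suc t)"
    proof -
      have "Suc q * n \<le> node_count n t * n" using q(1) by (intro mult_right_mono) auto
      then show ?thesis using jn by (simp add: algebra_simps)
    qed
    ultimately show ?case by blast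
  qed
  from step[of ?K] obtain q where q: "q < node_count n ?K" "sqdist d (x q) z \<le> r - real ?K * (r / real ?K)"
    by auto
  have "real ?K \<noteq> 0" unfolding K using d0 by simp
  then have "real ?K * (r / real ?K) = r" by simp
  \<comment> \<open>The potential is exhausted, so this centre agrees with \<open>z\<close> and is
    itself within \<open>r\<close> of all of \<open>J\<close>.\<close>
  then have "sqdist d (x q) z = 0"
    using q(2) sqdist_nonneg[of d "x q" z] by linarith
  then have eq: "\<forall>i<d. x q i = z i" by (simp add: sqdist_eq_0_iff)
  have "sqdist d (x q) (x j) \<le> r * (1 + 1 / real d)\<^sup>2" if "j \<in> J" for j
  proof -
    have "sqdist d (x q) (x j) = sqdist d (x j) z"
      using eq by (subst sqdist_commute) (auto intro: sqdist_cong)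
    also have "\<dots> \<le> r * 1" using near[OF that] by simp
    also have "\<dots> \<le> r * (1 + 1 / real d)\<^sup>2"
      using r d0 by (intro mult_left_mono) (auto intro: one_le_power)
    finally show ?thesis .
  qed
  with neg q(1) show False by blast
qed

section \<open>Program logic\<close>

text \<open>Total correctness: halting is part of the claim. The two arrays are separate arguments
  so that invariants can address each directly.\<close>

definition run :: "com \<Rightarrow> (nat \<Rightarrow> nat) \<Rightarrow> (nat \<Rightarrow> real)
    \<Rightarrow> ((nat \<Rightarrow> nat) \<Rightarrow> (nat \<Rightarrow> real) \<Rightarrow> bool) \<Rightarrow> bool" where
  "run p N R Q \<longleftrightarrow> (\<exists>N' R'. exec p (N, R) (N', R') \<and> Q N' R')"

lemma run_mono: "run p N R Q \<Longrightarrow> (\<And>N R. Q N R \<Longrightarrow> Q' N R) \<Longrightarrow> run p N R Q'"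
  by (auto simp: run_def)

lemma run_Skip: "Q N R \<Longrightarrow> run Skip N R Q"
  by (auto simp: run_def intro: exec.Skip)

lemma run_NAssign: "Q (N(nval a (N, R) := nval e (N, R))) R \<Longrightarrow> run (NAssign a e) N R Q"
  using exec.NAssign[of a e "(N, R)"] by (auto simp: run_def)

lemma run_RAssign: "Q N (R(nval a (N, R) := rval e (N, R))) \<Longrightarrow> run (RAssign a e) N R Q"
  using exec.RAssign[of a e "(N, R)"] by (auto simp: run_def)

lemma run_Seq: "run p N R (\<lambda>N R. run q N R Q) \<Longrightarrow> run (Seq p q) N R Q"
  by (auto simp: run_def intro: exec.Seq)

lemma run_Cond:
  "(bval b (N, R) \<Longrightarrow> run p N R Q) \<Longrightarrow> (\<not> bval b (N, R) \<Longrightarrow> run q N R Q) \<Longrightarrow> run (Cond b p q) N R Q"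
  by (cases "bval b (N, R)") (auto simp: run_def intro: exec.CondTrue exec.CondFalse)

text \<open>The invariant carries the number \<open>k\<close> of completed iterations, and \<open>m\<close> bounds it.\<close>

lemma run_While:
  assumes init: "I 0 N R"
    and step: "\<And>k N R. I k N R \<Longrightarrow> bval b (N, R) \<Longrightarrow> run p N R (I (Suc k))"
    and stop: "\<And>N R. I m N R \<Longrightarrow> \<not> bval b (N, R)"
    and final: "\<And>k N R. I k N R \<Longrightarrow> \<not> bval b (N, R) \<Longrightarrow> Q N R"
  shows "run (While b p) N R Q"
proof -
  have "run (While b p) N R Q" if "I k N R" "k \<le> m" for k N R
    using that
  proof (induction "m - k" arbitrary: k N R)
    case 0
    then have "\<not> bval b (N, R)" using stop by simp
    with final[OF 0(2)] show ?case
      using exec.WhileFalse[of b "(N, R)" p] by (auto simp: run_def)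
  next
    case (Suc l)
    show ?case
    proof (cases "bval b (N, R)")
      case True
      then obtain N' R' where *: "exec p (N, R) (N', R')" "I (Suc k) N' R'"
        using step[OF Suc.prems(1)] by (auto simp: run_def)
      then have "run (While b p) N' R' Q"
        using Suc.hyps(1)[of "Suc k" N' R'] Suc.hyps(2) by simp
      with True * show ?thesis
        by (auto simp: run_def intro: exec.WhileTrue)
    next
      case False
      with final[OF Suc.prems(1)] show ?thesis
        using exec.WhileFalse[of b "(N, R)" p] by (auto simp: run_def)
    qed
  qed
  then show ?thesis using init by blast
qed

definition For :: "nat \<Rightarrow> nexp \<Rightarrow> com \<Rightarrow> com" where
  "For v e p = Seq (NAssign (NLit v) (NLit 0))
     (While (NLess (NCell (NLit v)) e) (Seq p (NAssign (NLit v) (NPlus (NCell (NLit v)) (NLit 1)))))"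

text \<open>The bound \<open>e\<close> is evaluated anew at every test, so the invariant must fix
  its value at \<open>m\<close>. The body has to leave the counter at \<open>k\<close>; the
  increment follows it.\<close>

lemma run_For:
  assumes init: "I 0 (N(v := 0)) R"
    and bound: "\<And>k N R. I k N R \<Longrightarrow> N v = k \<Longrightarrow> nval e (N, R) = m"
    and step: "\<And>k N R. k < m \<Longrightarrow> N v = k \<Longrightarrow> I k N R \<Longrightarrow>
       run p N R (\<lambda>N' R'. N' v = k \<and> I (Suc k) (N'(v := Suc k)) R')"
    and final: "\<And>N R. I m N R \<Longrightarrow> N v = m \<Longrightarrow> Q N R"
  shows "run (For v e p) N R Q"
proof -
  let ?J = "\<lambda>k N R. k \<le> m \<and> N v = k \<and> I k N R"
  have step': "run (Seq p (NAssign (NLit v) (NPlus (NCell (NLit v)) (NLit 1)))) N R (?J (Suc k))"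
    if "?J k N R" "bval (NLess (NCell (NLit v)) e) (N, R)" for k N R
  proof -
    from that have km: "k < m" using bound[of k N R] by simp
    show ?thesis
      by (rule run_Seq, rule run_mono[OF step[of k N R]]; (rule run_NAssign)?) (use that km in auto)
  qed
  show ?thesis
    unfolding For_def
  proof (rule run_Seq, rule run_NAssign, rule run_While[where I = ?J and m = m])
    show "?J 0 (N(nval (NLit v) (N, R) := nval (NLit 0) (N, R))) R"
      using init by simp
  next
    fix k N R assume "?J k N R" "\<not> bval (NLess (NCell (NLit v)) e) (N, R)"
    then show "Q N R" using bound[of k N R] final[of N R] by (cases "k = m") auto
  next
    fix N R assume "?J m N R"
    then show "\<not> bval (NLess (NCell (NLit v)) e) (N, R)" using bound[of m N R] by simp
  qed (use step' in blast)
qed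

text \<open>
  The natural cells of the program hold: 0 the dimension, 1 the number of points, 2 the address of
  the real scratch area, 3 the number of centres searched, 4 to 7 loop counters, 8 the number of
  points covered, 9 whether a ball has been found, 10 the centre of the best one. Centre \<open>q\<close> starts
  at the real address \<open>2 + q * d\<close>, so that the input is already the list of roots. The scratch
  cells are: 0 the current squared radius, 1 a squared distance to be compared with it, 2 the best
  squared radius, 3 its approximate square root.
\<close>

abbreviation V :: "nat \<Rightarrow> nexp" where
  "V k \<equiv> NCell (NLit k)"

definition coord :: "nexp \<Rightarrow> nexp" where
  "coord q = NPlus (NLit 2) (NPlus (NTimes q (V 0)) (V 7))"

definition scratch :: "nat \<Rightarrow> nexp" where
  "scratch k = NPlus (V 2) (NLit k)"

definition node :: "nat \<Rightarrow> (nat \<Rightarrow> real) \<Rightarrow> nat \<Rightarrow> nat \<Rightarrow> real" where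
  "node d R q i = R (2 + (q * d + i))"

lemma nval_coord [simp]: "nval (coord q) (N, R) = 2 + (nval q (N, R) * N 0 + N 7)"
  by (simp add: coord_def)

lemma nval_scratch [simp]: "nval (scratch k) (N, R) = N 2 + k"
  by (simp add: scratch_def)

text \<open>A frame rule: writes at or above \<open>W\<close>, in particular to the scratch area, do
  not change distances between centres stored below \<open>W\<close>.\<close>

lemma sqdist_node_cong:
  assumes "\<And>a. a < W \<Longrightarrow> R' a = R a" "2 + (q * d + d) \<le> W" "2 + (l * d + d) \<le> W"
  shows "sqdist d (node d R' q) (node d R' l) = sqdist d (node d R q) (node d R l)"
  using assms by (intro sqdist_cong) (auto simp: node_def)

section \<open>The program\<close>

text \<open>The scratch area starts beyond all generated centres, which include the children of
  those searched. The extra \<open>d + d * d\<close> cells keep it clear of the output as well, so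
  the radius survives while the matrix is written.\<close>

definition setup_prog :: com where
  "setup_prog = Seq (NAssign (NLit 3) (V 1))
     (Seq (For 4 (NPlus (NTimes (V 0) (V 0)) (V 0))
        (NAssign (NLit 3) (NPlus (V 1) (NTimes (V 1) (V 3)))))
      (NAssign (NLit 2) (NPlus (NLit 2)
        (NPlus (NTimes (NPlus (V 1) (NTimes (V 1) (V 3))) (V 0)) (NPlus (V 0) (NTimes (V 0) (V 0)))))))"

lemma run_setup:
  assumes "N 0 = d" "N 1 = n"
  shows "run setup_prog N R (\<lambda>N' R'. R' = R \<and> N' 0 = d \<and> N' 1 = n \<and> N' 3 = node_count n (d * d + d) \<and>
     N' 2 = 2 + ((n + n * node_count n (d * d + d)) * d + (d + d * d)))"
  unfolding setup_prog_def
proof (rule run_Seq, rule run_NAssign, rule run_Seq, rule run_For[where m = "d * d + d" and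
    I = "\<lambda>k N' R'. R' = R \<and> N' 0 = d \<and> N' 1 = n \<and> N' 3 = node_count n k"])
qed (use assms in \<open>auto intro!: run_NAssign\<close>)

section \<open>Growing the forest of centres\<close>

definition grow_prog :: com where
  "grow_prog = For 4 (V 3) (For 5 (V 1) (For 7 (V 0)
     (RAssign (coord (NPlus (V 1) (NPlus (NTimes (V 4) (V 1)) (V 5))))
       (RPlus (RCell (coord (V 5)))
         (RTimes (RDivide (ROfNat (V 0)) (RPlus (ROfNat (V 0)) (ROfNat (NLit 1))))
           (RMinus (RCell (coord (V 4))) (RCell (coord (V 5)))))))))"

text \<open>\<open>m\<close> counts the coordinates written so far, in the order of the triple loop.
  The preserved prefix is the whole input, with \<open>\<delta>\<close> and \<open>\<gamma>\<close>
  at its start.\<close>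

definition tree_upto :: "nat \<Rightarrow> nat \<Rightarrow> (nat \<Rightarrow> real) \<Rightarrow> nat \<Rightarrow> (nat \<Rightarrow> real) \<Rightarrow> bool" where
  "tree_upto d n R0 m R \<longleftrightarrow> (\<forall>a < 2 + n * d. R a = R0 a) \<and>
     (\<forall>q j i. j < n \<longrightarrow> i < d \<longrightarrow> (q * n + j) * d + i < m \<longrightarrow>
        node d R (n + (q * n + j)) i
          = node d R j i + real d / (real d + 1) * (node d R q i - node d R j i))"

lemma block_index_unique:
  fixes q q' n j j' :: nat
  assumes "q * n + j = q' * n + j'" "j < n" "j' < n"
  shows "q = q' \<and> j = j'"
proof -
  have "(q * n + j) div n = q" "(q' * n + j') div n = q'" using assms(2,3) by auto
  then have "q = q'" using assms by simp
  then show ?thesis using assms by simp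
qed

lemma block_index_less:
  fixes q m n j :: nat
  assumes "q < m" "j < n"
  shows "q * n + j < m * n"
proof -
  have "Suc q * n \<le> m * n" using assms by (intro mult_right_mono) auto
  then show ?thesis using assms by simp
qed

text \<open>Cells are written in increasing order, and each equation refers to roots and a parent,
  all stored below the child. Hence the new write leaves the earlier equations intact.\<close>

lemma tree_upto_step:
  assumes "tree_upto d n R0 ((q * n + j) * d + i) R" "j < n" "i < d"
  shows "tree_upto d n R0 (Suc ((q * n + j) * d + i))
    (R(2 + ((n + (q * n + j)) * d + i) :=
       node d R j i + real d / (real d + 1) * (node d R q i - node d R j i)))"
    (is "tree_upto d n R0 _ (R(?A := ?x))")
proof -
  let ?m = "(q * n + j) * d + i"
  have A: "?A = 2 + (n * d + ?m)" by (simp add: algebra_simps)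
  have nd: "n * d > 0" using assms by auto
  have low: "node d (R(?A := ?x)) j' i' = node d R j' i'" if "j' < n" "i' < d" for j' i'
    using block_index_less[OF that] unfolding A by (auto simp: node_def)
  \<comment> \<open>Since \<open>n \<ge> 1\<close>, the parent number \<open>q'\<close> is at most
    \<open>q' * n + j'\<close>, so the parent's cell lies below \<open>?A\<close>.\<close>
  have mid: "node d (R(?A := ?x)) q' i' = node d R q' i'" if "(q' * n + j') * d + i' \<le> ?m" for q' j' i'
  proof -
    have "q' * 1 \<le> q' * n" using assms by (intro mult_left_mono) auto
    then have "q' * d \<le> (q' * n + j') * d" by (intro mult_right_mono trans_le_add1) auto
    then have "q' * d + i' < n * d + ?m" using that nd by linarith
    then show ?thesis unfolding A by (auto simp: node_def)
  qed
  show ?thesis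
    unfolding tree_upto_def
  proof (intro conjI allI impI)
    fix a assume "a < 2 + n * d"
    then show "(R(?A := ?x)) a = R0 a" using assms(1) unfolding A by (auto simp: tree_upto_def)
  next
    fix q' j' i' assume *: "j' < n" "i' < d" "(q' * n + j') * d + i' < Suc ?m"
    have "node d (R(?A := ?x)) (n + (q' * n + j')) i'
        = node d R j' i' + real d / (real d + 1) * (node d R q' i' - node d R j' i')"
    proof (cases "(q' * n + j') * d + i' = ?m")
      case True
      \<comment> \<open>Mixed-radix digits are unique: first in base \<open>d\<close>, then in base
        \<open>n\<close>.\<close>
      from block_index_unique[OF True] * assms have 1: "q' * n + j' = q * n + j" "i' = i" by auto
      from block_index_unique[OF 1(1)] * assms have "q' = q" "j' = j" by auto
      with 1 show ?thesis by (simp add: node_def)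
    next
      case False
      then have "2 + ((n + (q' * n + j')) * d + i') \<noteq> ?A"
        unfolding A by (simp add: algebra_simps)
      then have "node d (R(?A := ?x)) (n + (q' * n + j')) i' = node d R (n + (q' * n + j')) i'"
        by (simp add: node_def)
      with False assms(1) * show ?thesis by (simp add: tree_upto_def)
    qed
    with low[OF *(1,2)] mid[of q' j' i'] *(3)
    show "node d (R(?A := ?x)) (n + (q' * n + j')) i' = node d (R(?A := ?x)) j' i'
        + real d / (real d + 1) * (node d (R(?A := ?x)) q' i' - node d (R(?A := ?x)) j' i')"
      by simp
  qed
qed

lemma run_grow:
  assumes "N 0 = d" "N 1 = n" "N 3 = M"
  shows "run grow_prog N R (\<lambda>N' R'. (\<forall>a<4. N' a = N a) \<and> tree_upto d n R (M * n * d) R')"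
proof -
  let ?F = "\<lambda>N'. \<forall>a<4. N' a = N a"
  have inner: "run (For 7 (V 0)
     (RAssign (coord (NPlus (V 1) (NPlus (NTimes (V 4) (V 1)) (V 5))))
       (RPlus (RCell (coord (V 5)))
         (RTimes (RDivide (ROfNat (V 0)) (RPlus (ROfNat (V 0)) (ROfNat (NLit 1))))
           (RMinus (RCell (coord (V 4))) (RCell (coord (V 5)))))))) N' R'
       (\<lambda>N'' R''. (?F N'' \<and> N'' 4 = q \<and> tree_upto d n R ((q * n + Suc j) * d) R'') \<and> N'' 5 = j)"
    if "?F N'" "N' 4 = q" "N' 5 = j" "j < n" "tree_upto d n R ((q * n + j) * d) R'" for N' R' q j
  proof (rule run_For[where m = d and I = "\<lambda>i N'' R''. ?F N'' \<and> N'' 4 = q \<and> N'' 5 = j \<and>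
        tree_upto d n R ((q * n + j) * d + i) R''"], goal_cases)
    case (3 i N'' R'')
    then have "N'' 0 = d" "N'' 1 = n" using assms by auto
    with 3 tree_upto_step[of d n R q j i R''] that show ?case
      by (intro run_RAssign) (simp add: node_def)
  next
    case (4 N'' R'')
    then show ?case by (simp add: algebra_simps)
  qed (use that assms in auto)
  have outer: "run (For 5 (V 1) (For 7 (V 0)
     (RAssign (coord (NPlus (V 1) (NPlus (NTimes (V 4) (V 1)) (V 5))))
       (RPlus (RCell (coord (V 5)))
         (RTimes (RDivide (ROfNat (V 0)) (RPlus (ROfNat (V 0)) (ROfNat (NLit 1))))
           (RMinus (RCell (coord (V 4))) (RCell (coord (V 5))))))))) N' R'
       (\<lambda>N'' R''. (?F N'' \<and> tree_upto d n R (Suc q * n * d) R'') \<and> N'' 4 = q)"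
    if "?F N'" "N' 4 = q" "tree_upto d n R (q * n * d) R'" for N' R' q
  proof (rule run_For[where m = n and I = "\<lambda>j N'' R''. ?F N'' \<and> N'' 4 = q \<and>
        tree_upto d n R ((q * n + j) * d) R''"], goal_cases)
    case (3 j N'' R'')
    then show ?case
      by (intro run_mono[OF inner[of N'' q j R'']]) auto
  next
    case (4 N'' R'')
    then show ?case by (simp add: algebra_simps)
  qed (use that assms in auto)
  show ?thesis
    unfolding grow_prog_def
  proof (rule run_For[where m = M and I = "\<lambda>q N'' R''. ?F N'' \<and>
        tree_upto d n R (q * n * d) R''"], goal_cases)
    case (3 q N'' R'')
    then show ?case
      by (intro run_mono[OF outer[of N'' q R'']]) auto
  qed (use assms in \<open>auto simp: tree_upto_def\<close>)
qed

section \<open>Squared distances and coverage counts\<close>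

definition dist_prog :: "nat \<Rightarrow> nat \<Rightarrow> nat \<Rightarrow> com" where
  "dist_prog k u v = Seq (RAssign (scratch k) (ROfNat (NLit 0))) (For 7 (V 0)
     (RAssign (scratch k) (RPlus (RCell (scratch k))
       (RTimes (RMinus (RCell (coord (V u))) (RCell (coord (V v))))
         (RMinus (RCell (coord (V u))) (RCell (coord (V v))))))))"

text \<open>The sum is accumulated in a scratch cell; the two address bounds ensure that the
  coordinates read are not disturbed by it.\<close>

lemma run_dist:
  assumes "u \<notin> {0, 2, 7}" "v \<notin> {0, 2, 7}" "N 0 = d"
    and "2 + (N u * d + d) \<le> N 2" "2 + (N v * d + d) \<le> N 2"
    and "Q (N(7 := d)) (R(N 2 + k := sqdist d (node d R (N u)) (node d R (N v))))"
  shows "run (dist_prog k u v) N R Q"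
  unfolding dist_prog_def
proof (rule run_Seq, rule run_RAssign, rule run_For[where m = d and
    I = "\<lambda>i N' R'. N' = N(7 := i) \<and>
      R' = R(N 2 + k := (\<Sum>i'<i. (node d R (N u) i' - node d R (N v) i')\<^sup>2))"], goal_cases)
  case (3 i N' R')
  then show ?case
    using assms by (intro run_RAssign) (auto simp: node_def power2_eq_square)
qed (use assms in \<open>auto simp: sqdist_def\<close>)

definition count_prog :: com where
  "count_prog = Seq (NAssign (NLit 8) (NLit 0)) (For 6 (V 1) (Seq (dist_prog 1 4 6)
     (Cond (RLess (RCell (scratch 0)) (RCell (scratch 1))) Skip
       (NAssign (NLit 8) (NPlus (V 8) (NLit 1))))))"

text \<open>Indices instead of points, since the program counts list positions; \<open>r\<close> is
  a squared radius.\<close>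

definition covered :: "nat \<Rightarrow> nat \<Rightarrow> (nat \<Rightarrow> real) \<Rightarrow> nat \<Rightarrow> real \<Rightarrow> nat set" where
  "covered d n R q r = {l. l < n \<and> sqdist d (node d R q) (node d R l) \<le> r}"

lemma card_covered_Suc:
  "card (covered d (Suc l) R q r) =
     (if sqdist d (node d R q) (node d R l) \<le> r then Suc (card (covered d l R q r))
      else card (covered d l R q r))"
proof -
  have "covered d (Suc l) R q r =
     (if sqdist d (node d R q) (node d R l) \<le> r then insert l (covered d l R q r)
      else covered d l R q r)"
    by (auto simp: covered_def less_Suc_eq)
  moreover have "finite (covered d l R q r)" "l \<notin> covered d l R q r"
    by (auto simp: covered_def)
  ultimately show ?thesis by simp
qed

lemma run_count:
  assumes "N 0 = d" "N 1 = n" "2 + (N 4 * d + d) \<le> N 2" "2 + n * d \<le> N 2"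
  shows "run count_prog N R (\<lambda>N' R'. (\<forall>a. a \<notin> {6, 7, 8} \<longrightarrow> N' a = N a) \<and>
    (\<forall>a. a \<noteq> N 2 + 1 \<longrightarrow> R' a = R a) \<and> N' 8 = card (covered d n R (N 4) (R (N 2))))"
  unfolding count_prog_def
proof (rule run_Seq, rule run_NAssign, rule run_For[where m = n and
    I = "\<lambda>l N' R'. (\<forall>a. a \<notin> {6, 7, 8} \<longrightarrow> N' a = N a) \<and>
    (\<forall>a. a \<noteq> N 2 + 1 \<longrightarrow> R' a = R a) \<and> N' 8 = card (covered d l R (N 4) (R (N 2)))"], goal_cases)
  case (3 l N' R')
  have "Suc l * d \<le> n * d" using 3 by (intro mult_right_mono) auto
  then have l: "2 + (l * d + d) \<le> N 2" using assms by simp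
  have eq: "sqdist d (node d R' (N 4)) (node d R' l) = sqdist d (node d R (N 4)) (node d R l)"
    using 3 l assms by (intro sqdist_node_cong[of "N 2"]) auto
  show ?case
    using 3 l assms eq
    by (intro run_Seq run_dist[where d = d] run_Cond run_Skip run_NAssign)
      (auto simp: card_covered_Suc)
qed (use assms in \<open>auto simp: covered_def\<close>)

section \<open>Search for the smallest admissible ball\<close>

definition search_prog :: com where
  "search_prog = Seq (NAssign (NLit 9) (NLit 0)) (Seq (RAssign (scratch 2) (ROfNat (NLit 0)))
    (For 4 (V 3) (For 5 (V 1)
      (Seq (dist_prog 0 4 5) (Seq count_prog
        (Cond (Conj (Neg (RLess (ROfNat (V 8)) (RTimes (RCell (NLit 0)) (ROfNat (V 1)))))
            (Neg (Conj (NLess (NLit 0) (V 9)) (Neg (RLess (RCell (scratch 0)) (RCell (scratch 2)))))))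
          (Seq (RAssign (scratch 2) (RCell (scratch 0)))
            (Seq (NAssign (NLit 10) (V 4)) (NAssign (NLit 9) (NLit 1))))
          Skip))))))"

text \<open>Cell 0 of the reals holds \<open>\<delta>\<close>. The threshold is the full
  \<open>\<delta> n\<close>, which is at least the required
  \<open>\<delta> (1 - \<gamma>) n\<close>.\<close>

definition admissible :: "nat \<Rightarrow> nat \<Rightarrow> (nat \<Rightarrow> real) \<Rightarrow> nat \<Rightarrow> real \<Rightarrow> bool" where
  "admissible d n R q r \<longleftrightarrow> R 0 * real n \<le> real (card (covered d n R q r))"

text \<open>\<open>S\<close> holds the pairs of a centre and a point already tried. Distances from a
  centre to points suffice as radii, because shrinking a ball until it meets its farthest covered
  point loses nothing. The value 0 before any success gives the root computation a valid
  input.\<close>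

definition best_among ::
  "nat \<Rightarrow> nat \<Rightarrow> (nat \<Rightarrow> nat) \<Rightarrow> (nat \<Rightarrow> real) \<Rightarrow> (nat \<times> nat) set
    \<Rightarrow> (nat \<Rightarrow> nat) \<Rightarrow> (nat \<Rightarrow> real) \<Rightarrow> bool" where
  "best_among d n N0 R0 S N R \<longleftrightarrow>
     (\<forall>a<4. N a = N0 a) \<and> (\<forall>a < N0 2. R a = R0 a) \<and>
     (if N 9 = 0 then R (N0 2 + 2) = 0
      else N 10 < N0 3 \<and> R (N0 2 + 2) \<ge> 0 \<and> admissible d n R0 (N 10) (R (N0 2 + 2))) \<and>
     (\<forall>(q, j) \<in> S. let r = sqdist d (node d R0 q) (node d R0 j) in
        admissible d n R0 q r \<longrightarrow> N 9 \<noteq> 0 \<and> R (N0 2 + 2) \<le> r)"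

lemma run_search_step:
  assumes "N0 0 = d" "N0 1 = n" "2 + N0 3 * d \<le> N0 2" "2 + n * d \<le> N0 2"
    and "best_among d n N0 R0 S N R" "N 4 = q" "N 5 = j" "q < N0 3" "j < n"
  shows "run (Seq (dist_prog 0 4 5) (Seq count_prog
        (Cond (Conj (Neg (RLess (ROfNat (V 8)) (RTimes (RCell (NLit 0)) (ROfNat (V 1)))))
            (Neg (Conj (NLess (NLit 0) (V 9)) (Neg (RLess (RCell (scratch 0)) (RCell (scratch 2)))))))
          (Seq (RAssign (scratch 2) (RCell (scratch 0)))
            (Seq (NAssign (NLit 10) (V 4)) (NAssign (NLit 9) (NLit 1))))
          Skip))) N R
     (\<lambda>N' R'. best_among d n N0 R0 (insert (q, j) S) N' R' \<and> N' 4 = q \<and> N' 5 = j)"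
proof -
  define r where "r = sqdist d (node d R0 q) (node d R0 j)"
  have N: "N 0 = d" "N 1 = n" "N 2 = N0 2" "N 3 = N0 3"
    using assms by (auto simp: best_among_def)
  have "Suc q * d \<le> N0 3 * d" using assms by (intro mult_right_mono) auto
  then have q: "2 + (q * d + d) \<le> N0 2" using assms by simp
  have n: "2 + (l * d + d) \<le> N0 2" if "l < n" for l
  proof -
    have "Suc l * d \<le> n * d" using that by (intro mult_right_mono) auto
    then show ?thesis using assms by simp
  qed
  have r: "sqdist d (node d R q) (node d R j) = r"
    unfolding r_def using assms q n by (intro sqdist_node_cong[of "N0 2"]) (auto simp: best_among_def)
  have R0: "R 0 = R0 0" using assms by (auto simp: best_among_def)
  let ?N = "N(7 := d)" and ?R = "R(N0 2 := r)"
  have cov: "covered d n ?R q r = covered d n R0 q r"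
  proof -
    have "sqdist d (node d ?R q) (node d ?R l) = sqdist d (node d R0 q) (node d R0 l)" if "l < n" for l
      using assms q n[OF that] by (intro sqdist_node_cong[of "N0 2"]) (auto simp: best_among_def)
    then show ?thesis by (auto simp: covered_def)
  qed
  show ?thesis
  proof (rule run_Seq, rule run_dist[where d = d], goal_cases)
    case 6
    show ?case
    proof (rule run_Seq, rule run_mono[OF run_count[where d = d and n = n]], goal_cases)
      case (5 N' R')
      have N': "N' a = N a" if "a \<notin> {6, 7, 8}" for a using 5 that by simp
      have R': "R' (N0 2) = r" "R' (N0 2 + 2) = R (N0 2 + 2)" "\<forall>a < N0 2. R' a = R0 a"
        using 5 assms N r by (auto simp: best_among_def)
      have c: "N' 8 = card (covered d n R0 q r)"
        using 5 assms N r cov by simp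
      show ?case
      proof (rule run_Cond, goal_cases)
        case 1
        \<comment> \<open>The guard expresses this disjunction as a negated conjunction, and the
          weak inequality as a negated \<open>RLess\<close>.\<close>
        then have *: "admissible d n R0 q r" "N 9 = 0 \<or> r < R (N0 2 + 2)"
          using N N' R' R0 c assms by (auto simp: admissible_def best_among_def)
        have "best_among d n N0 R0 (insert (q, j) S) (N'(10 := q, 9 := 1)) (R'(N0 2 + 2 := r))"
          using assms(5,8) N' R' * sqdist_nonneg[of d "node d R0 q" "node d R0 j"]
          unfolding best_among_def Let_def r_def[symmetric]
          by (force simp flip: r_def simp del: add_2_eq_Suc' split: if_splits)
        then show ?case
          using N N' R' assms by (intro run_Seq run_RAssign run_NAssign) simp
      next
        case 2
        then have *: "admissible d n R0 q r \<longrightarrow> N 9 \<noteq> 0 \<and> R (N0 2 + 2) \<le> r"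
          using N N' R' R0 c assms by (auto simp: admissible_def best_among_def)
        have "best_among d n N0 R0 (insert (q, j) S) N' R'"
          using assms(5) N' R' * unfolding best_among_def Let_def
          by (simp flip: r_def del: add_2_eq_Suc')
        then show ?case
          using N' assms by (intro run_Skip) simp
      qed
    qed (use assms N q in auto)
  qed (use assms N q n[OF \<open>j < n\<close>] in auto)
qed

lemma run_search:
  assumes "N 0 = d" "N 1 = n" "2 + N 3 * d \<le> N 2" "2 + n * d \<le> N 2"
  shows "run search_prog N R (best_among d n N R {(q, j). q < N 3 \<and> j < n})"
proof -
  have inv: "N' 0 = d \<and> N' 1 = n \<and> N' 3 = N 3" if "best_among d n N R S N' R'" for S N' R'
    using that assms by (auto simp: best_among_def)
  have frame: "best_among d n N R S (N'(a := x)) R'"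
    if "best_among d n N R S N' R'" "a \<in> {4, 5}" for S N' R' a x
    using that by (auto simp: best_among_def)
  show ?thesis
    unfolding search_prog_def
  proof (rule run_Seq, rule run_NAssign, rule run_Seq, rule run_RAssign,
      rule run_For[where m = "N 3" and I = "\<lambda>q N' R'. best_among d n N R {(q', j). q' < q \<and> j < n} N' R'"],
      goal_cases)
    case (3 q N' R')
    show ?case
    proof (rule run_For[where m = n and I = "\<lambda>j N' R'. N' 4 = q \<and>
        best_among d n N R ({(q', j). q' < q \<and> j < n} \<union> {(q', j'). q' = q \<and> j' < j}) N' R'"], goal_cases)
      case (3 j N'' R'')
      let ?S = "{(q', j). q' < q \<and> j < n} \<union> {(q', j'). q' = q \<and> j' < j}"
      have S: "insert (q, j) ?S = {(q', j). q' < q \<and> j < n} \<union> {(q', j'). q' = q \<and> j' < Suc j}"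
        by auto
      have B: "best_among d n N R ?S N'' R''" "N'' 4 = q" "N'' 5 = j" "j < n"
        using 3 by simp_all
      show ?case
      proof (rule run_mono[OF run_search_step[OF assms B(1-3) \<open>q < N 3\<close> B(4)]])
        fix N3 R3
        assume 4: "best_among d n N R (insert (q, j) ?S) N3 R3 \<and> N3 4 = q \<and> N3 5 = j"
        then have "best_among d n N R (insert (q, j) ?S) (N3(5 := Suc j)) R3"
          by (blast intro: frame)
        with 4 show "N3 5 = j \<and> (N3(5 := Suc j)) 4 = q \<and> best_among d n N R
            ({(q', j). q' < q \<and> j < n} \<union> {(q', j'). q' = q \<and> j' < Suc j}) (N3(5 := Suc j)) R3"
          unfolding S by simp
      qed
    next
      case (4 N'' R'')
      have "{(q', j). q' < q \<and> j < n} \<union> {(q', j'). q' = q \<and> j' < n} = {(q', j). q' < Suc q \<and> j < n}"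
        by auto
      with 4 frame[of "{(q', j). q' < Suc q \<and> j < n}" N'' R'' 4 "Suc q"] show ?case by simp
    qed (use 3 inv frame in auto)
  qed (use assms inv in \<open>auto simp: best_among_def\<close>)
qed

section \<open>Approximate square root from above\<close>

definition sqrt_prog :: com where
  "sqrt_prog = Cond (RLess (ROfNat (NLit 0)) (RCell (scratch 2)))
     (Seq (RAssign (scratch 3) (RPlus (RCell (scratch 2)) (ROfNat (NLit 1))))
       (While (RLess (RTimes (RCell (scratch 2))
            (RTimes (RPlus (ROfNat (NLit 1)) (RDivide (ROfNat (NLit 1)) (ROfNat (V 0))))
              (RPlus (ROfNat (NLit 1)) (RDivide (ROfNat (NLit 1)) (ROfNat (V 0))))))
            (RTimes (RCell (scratch 3)) (RCell (scratch 3))))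
         (RAssign (scratch 3) (RDivide
            (RPlus (RCell (scratch 3)) (RDivide (RCell (scratch 2)) (RCell (scratch 3))))
            (ROfNat (NLit 2))))))
     (RAssign (scratch 3) (ROfNat (NLit 0)))"

text \<open>The new error is \<open>(x - s)\<^sup>2 / (2 * x)\<close>, hence nonnegative, and
  \<open>s\<^sup>2 / x \<le> s\<close> shows that it is at most half the old one.\<close>

lemma newton_sqrt_step:
  fixes s x :: real
  assumes "0 < s" "s \<le> x"
  shows "s \<le> (x + s\<^sup>2 / x) / 2" "(x + s\<^sup>2 / x) / 2 - s \<le> (x - s) / 2"
proof -
  define t where "t = s\<^sup>2 / x"
  have "(x + t) / 2 - s = (x - s)\<^sup>2 / (2 * x)"
    using assms by (simp add: t_def field_simps power2_eq_square)
  moreover have "(x - s)\<^sup>2 / (2 * x) \<ge> 0" using assms by simp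
  ultimately have "s \<le> (x + t) / 2" by linarith
  then show "s \<le> (x + s\<^sup>2 / x) / 2" by (simp add: t_def)
  have "t \<le> s" using assms by (simp add: t_def field_simps power2_eq_square)
  then have "(x + t) / 2 - s \<le> (x - s) / 2" by (simp add: field_simps)
  then show "(x + s\<^sup>2 / x) / 2 - s \<le> (x - s) / 2" by (simp add: t_def)
qed

text \<open>Halving of the error bounds the number of iterations. The value 0 needs its own branch:
  there the iteration would only halve \<open>x\<close> and never meet a relative error
  bound.\<close>

lemma run_sqrt:
  assumes d: "N 0 = d" "d \<ge> 1" and b: "R (N 2 + 2) = b" "b \<ge> 0"
  shows "run sqrt_prog N R (\<lambda>N' R'. N' = N \<and> (\<exists>x. R' = R(N 2 + 3 := x) \<and> x \<ge> 0 \<and> b \<le> x\<^sup>2 \<and>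
     x\<^sup>2 \<le> b * (1 + 1 / real d)\<^sup>2))"
proof (cases "b = 0")
  case True
  then show ?thesis
    using b by (auto simp: sqrt_prog_def intro!: run_Cond run_RAssign)
next
  case False
  define s where "s = sqrt b"
  have s: "s > 0" "s\<^sup>2 = b" using False b by (auto simp: s_def)
  have d0: "real d > 0" using d by simp
  \<comment> \<open>After \<open>m\<close> halvings the initial error, at most \<open>b + 1\<close>,
    is below \<open>s / d\<close>, which forces the loop test to fail.\<close>
  obtain m where m: "(b + 1) * real d / s < 2 ^ m"
    using real_arch_pow[of 2] by auto
  then have m': "(b + 1) / 2 ^ m < s / real d"
    using s d0 by (simp add: field_simps)
  define I where "I = (\<lambda>k N' R'. N' = N \<and> (\<exists>x. R' = R(N 2 + 3 := x) \<and> s \<le> x \<and> x - s \<le> (b + 1) / 2 ^ k))"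
  have cond: "bval (RLess (RTimes (RCell (scratch 2))
            (RTimes (RPlus (ROfNat (NLit 1)) (RDivide (ROfNat (NLit 1)) (ROfNat (V 0))))
              (RPlus (ROfNat (NLit 1)) (RDivide (ROfNat (NLit 1)) (ROfNat (V 0))))))
            (RTimes (RCell (scratch 3)) (RCell (scratch 3)))) (N, R(N 2 + 3 := x))
      \<longleftrightarrow> b * (1 + 1 / real d)\<^sup>2 < x\<^sup>2" for x
    using d b by (simp add: power2_eq_square)
  show ?thesis
    unfolding sqrt_prog_def
  proof (rule run_Cond, rule run_Seq, rule run_RAssign, rule run_While[where I = I and m = m], goal_cases)
    case 1
    \<comment> \<open>The start value \<open>b + 1\<close> thus lies above the root.\<close>
    have "2 * s \<le> s\<^sup>2 + 1" using zero_le_power2[of "s - 1"] by (simp add: power2_diff)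
    then have "s \<le> b + 1" using s by linarith
    then show ?case using s b by (auto simp: I_def intro!: exI[of _ "b + 1"])
  next
    case (2 k N' R')
    then obtain x where x: "N' = N" "R' = R(N 2 + 3 := x)" "s \<le> x" "x - s \<le> (b + 1) / 2 ^ k"
      by (auto simp: I_def)
    have "(x + b / x) / 2 - s \<le> (x - s) / 2" "s \<le> (x + b / x) / 2"
      using newton_sqrt_step[OF s(1) x(3)] unfolding s(2) by blast+
    moreover have "(x - s) / 2 \<le> (b + 1) / 2 ^ Suc k"
      using divide_right_mono[OF x(4), of 2] by (simp add: mult.commute)
    ultimately have "(x + b / x) / 2 - s \<le> (b + 1) / 2 ^ Suc k" "s \<le> (x + b / x) / 2"
      by linarith+
    then show ?case
      using x b by (intro run_RAssign) (auto simp: I_def)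
  next
    case (3 N' R')
    then obtain x where x: "N' = N" "R' = R(N 2 + 3 := x)" "s \<le> x" "x - s \<le> (b + 1) / 2 ^ m"
      by (auto simp: I_def)
    then have "x \<le> s * (1 + 1 / real d)" using m' by (simp add: algebra_simps)
    then have "x\<^sup>2 \<le> (s * (1 + 1 / real d))\<^sup>2" using x s by (intro power_mono) auto
    then show ?case using s cond x by (simp add: power_mult_distrib)
  next
    case (4 k N' R')
    then obtain x where x: "N' = N" "R' = R(N 2 + 3 := x)" "s \<le> x" by (auto simp: I_def)
    have "b \<le> x\<^sup>2" using power_mono[OF x(3), of 2] s by simp
    then show ?case using 4 x s cond by auto
  qed (use b False in auto)
qed

text \<open>
  The output overwrites the centres, but the centre copied first is read at addresses at least two
  above those written so far.
\<close>

definition output_prog :: com where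
  "output_prog = Seq (For 7 (V 0) (RAssign (V 7) (RCell (coord (V 10)))))
     (Seq (For 4 (NTimes (V 0) (V 0)) (RAssign (NPlus (V 0) (V 4)) (ROfNat (NLit 0))))
       (For 7 (V 0) (RAssign (NPlus (V 0) (NPlus (NTimes (V 7) (V 0)) (V 7))) (RCell (scratch 3)))))"

lemma run_output:
  assumes d: "N 0 = d" and q: "N 10 = q" and W: "d + d * d \<le> N 2"
  shows "run output_prog N R (\<lambda>N' R'. (\<forall>i<d. R' i = node d R q i) \<and>
     (\<forall>i<d. \<forall>j<d. R' (d + i * d + j) = (if i = j then R (N 2 + 3) else 0)))"
  unfolding output_prog_def
proof (rule run_Seq, rule run_For[where m = d and
    I = "\<lambda>i N' R'. N' = N(7 := i) \<and> R' = (\<lambda>a. if a < i then node d R q a else R a)"], goal_cases)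
  case (3 i N' R')
  then show ?case
    using d q by (intro run_RAssign) (auto simp: node_def fun_eq_iff)
next
  case (4 N1 R1)
  show ?case
  proof (rule run_Seq, rule run_For[where m = "d * d" and
      I = "\<lambda>k N' R'. (\<forall>a. a \<notin> {4, 7} \<longrightarrow> N' a = N a) \<and>
         R' = (\<lambda>a. if a < d then node d R q a else if a < d + k then 0 else R a)"], goal_cases)
    case (3 k N' R')
    then show ?case
      using d by (intro run_RAssign) (auto simp: fun_eq_iff)
  next
    case (4 N2 R2)
    show ?case
    proof (rule run_For[where m = d and
      I = "\<lambda>k N' R'. (\<forall>a. a \<notin> {4, 7} \<longrightarrow> N' a = N a) \<and> (\<forall>i<d. R' i = node d R q i) \<and>
        R' (N 2 + 3) = R (N 2 + 3) \<and>
        (\<forall>i<d. \<forall>j<d. R' (d + i * d + j) = (if i = j \<and> i < k then R (N 2 + 3) else 0))"], goal_cases)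
      case 1
      have "i * d + j < d * d" if "i < d" "j < d" for i j
        using block_index_less[OF that] .
      then show ?case using 4 W by auto
    next
      case (3 k N' R')
      have kk: "k * d + k < d * d" using block_index_less[of k d k d] 3 by simp
      \<comment> \<open>Writing the \<open>k\<close>-th diagonal entry touches no other matrix
        entry.\<close>
      have "d + i * d + j = d + (k * d + k) \<longleftrightarrow> i = k \<and> j = k" if "i < d" "j < d" for i j
        using block_index_unique[of i d j k k] that 3 by auto
      then show ?case
        using 3 d W kk by (intro run_RAssign) (auto simp: add.assoc)
    qed (use d in auto)
  qed (use 4 d in auto)
qed (use d in auto)

section \<open>The complete program\<close>

definition algorithm_prog :: com where
  "algorithm_prog = Seq setup_prog (Seq grow_prog (Seq search_prog (Seq sqrt_prog output_prog)))"

lemma le_node_count: "n \<le> node_count n t"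
  using node_count_mono[of 0 t n] by simp

lemma node_count_0: "node_count 0 t = 0"
  by (cases t) auto

text \<open>The interface between program and geometry: \<open>R1\<close> is the real array after
  growing the forest, and all claims about the result refer to it.\<close>

lemma run_algorithm:
  assumes "N 0 = d" "N 1 = n" "d \<ge> 1"
  defines "M \<equiv> node_count n (d * d + d)"
  shows "run algorithm_prog N R (\<lambda>N' R'. \<exists>R1 q b x found.
     tree_upto d n R (M * n * d) R1 \<and>
     (if found then q < M \<and> 0 \<le> b \<and> admissible d n R1 q b else b = 0) \<and>
     (\<forall>q<M. \<forall>j<n. let r = sqdist d (node d R1 q) (node d R1 j) in
        admissible d n R1 q r \<longrightarrow> found \<and> b \<le> r) \<and>
     0 \<le> x \<and> b \<le> x\<^sup>2 \<and> x\<^sup>2 \<le> b * (1 + 1 / real d)\<^sup>2 \<and>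
     (found \<longrightarrow> (\<forall>i<d. R' i = node d R1 q i)) \<and>
     (\<forall>i<d. \<forall>j<d. R' (d + i * d + j) = (if i = j then x else 0)))"
  unfolding algorithm_prog_def
proof (rule run_Seq, rule run_mono[OF run_setup[OF assms(1,2)]], goal_cases)
  case (1 N0 R0)
  define W where "W = 2 + ((n + n * M) * d + (d + d * d))"
  have N0: "R0 = R" "N0 0 = d" "N0 1 = n" "N0 3 = M" "N0 2 = W"
    using 1 by (auto simp: M_def W_def)
  show ?case
  proof (rule run_Seq, rule run_mono[OF run_grow[OF N0(2-4)]], goal_cases)
    case (1 N1 R1)
    then have N1: "N1 0 = d" "N1 1 = n" "N1 3 = M" "N1 2 = W"
      and tree: "tree_upto d n R (M * n * d) R1" using N0 by auto
    have "M \<le> n + n * M"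
      using le_node_count[of n "d * d + d"] by (cases n) (auto simp: M_def node_count_0)
    then have "M * d \<le> (n + n * M) * d" by (intro mult_right_mono) auto
    then have W: "2 + N1 3 * d \<le> N1 2" "2 + n * d \<le> N1 2" "d + d * d \<le> N1 2"
      unfolding N1 by (auto simp: W_def algebra_simps)
    show ?case
    proof (rule run_Seq, rule run_mono[OF run_search[OF N1(1,2) W(1,2)]], goal_cases)
      case (1 N2 R2)
      have N2: "N2 0 = d" "N2 2 = W" using 1 N1 by (auto simp: best_among_def)
      define b where "b = R2 (W + 2)"
      have b: "if N2 9 \<noteq> 0 then N2 10 < M \<and> 0 \<le> b \<and> admissible d n R1 (N2 10) b else b = 0"
        using 1 N1 by (simp add: best_among_def b_def split: if_splits)
      then have "b \<ge> 0" by (auto split: if_splits)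
      have best: "\<forall>q<M. \<forall>j<n. let r = sqdist d (node d R1 q) (node d R1 j) in
        admissible d n R1 q r \<longrightarrow> N2 9 \<noteq> 0 \<and> b \<le> r"
        using 1 N1 by (simp add: best_among_def b_def Let_def)
      show ?case
      proof (rule run_Seq, rule run_mono[OF run_sqrt[where d = d and b = b]], goal_cases)
        case (5 N3 R3)
        then obtain x where x: "N3 = N2" "R3 = R2(W + 3 := x)" "x \<ge> 0" "b \<le> x\<^sup>2"
            "x\<^sup>2 \<le> b * (1 + 1 / real d)\<^sup>2"
          using N2 by auto
        have "run output_prog N3 R3 (\<lambda>N' R'. (\<forall>i<d. R' i = node d R3 (N2 10) i) \<and>
            (\<forall>i<d. \<forall>j<d. R' (d + i * d + j) = (if i = j then R3 (N3 2 + 3) else 0)))"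
          using N2 N1 x W by (intro run_output) auto
        then show ?case
        proof (rule run_mono, goal_cases)
          case (1 N4 R4)
          \<comment> \<open>Neither the search nor the root computation writes below
            \<open>W\<close>, so the chosen centre is still the one in \<open>R1\<close>.\<close>
          have eq: "node d R3 (N2 10) i = node d R1 (N2 10) i" if "N2 9 \<noteq> 0" "i < d" for i
          proof -
            have "N2 10 * d + i < M * d" using block_index_less[of "N2 10" M i d] b that by simp
            then show ?thesis
              using W \<open>best_among d n N1 R1 _ N2 R2\<close> N1 x by (auto simp: node_def best_among_def)
          qed
          show ?case
            using tree b best x 1 N2 eq
            by (intro exI[of _ R1] exI[of _ "N2 10"] exI[of _ b] exI[of _ x] exI[of _ "N2 9 \<noteq> 0"])
              (simp add: Let_def)
        qed
      qed (use N2 assms b_def \<open>b \<ge> 0\<close> in auto)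
    qed
  qed
qed

section \<open>Coverage and volume of the output\<close>

lemma tree_upto_node:
  assumes "tree_upto d n R0 (M * n * d) R" "q < M" "j < n" "i < d"
  shows "node d R (n + (q * n + j)) i
    = node d R j i + real d / (real d + 1) * (node d R q i - node d R j i)"
proof -
  have "(q * n + j) * d + i < M * n * d"
    using assms by (intro block_index_less) 
  then show ?thesis using assms by (simp add: tree_upto_def)
qed

lemma tree_upto_input:
  assumes "tree_upto d (length ys) (snd (input_store d ys \<delta> \<gamma>)) m R" "l < length ys"
  shows "R 0 = \<delta>" "\<And>i. i < d \<Longrightarrow> node d R l i = (ys ! l) i"
proof -
  show "R 0 = \<delta>" using assms by (simp add: tree_upto_def input_store_def)
  fix i assume "i < d"
  then show "node d R l i = (ys ! l) i"
    using assms block_index_less[of l "length ys" i d]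
    by (simp add: tree_upto_def input_store_def node_def)
qed

lemma powr_minus_half_ge:
  assumes "d \<ge> 1"
  shows "1 / real d \<le> real d powr (- 1 / 2)"
proof -
  have "real d powr (- 1) \<le> real d powr (- 1 / 2)"
    using assms by (intro powr_mono) auto
  then show ?thesis using assms by (simp add: powr_minus inverse_eq_divide)
qed

text \<open>One squared factor is the loss of the search, the other that of the approximate
  root.\<close>

lemma output_volume:
  assumes "d \<ge> 1" "0 \<le> R" "0 \<le> x" "x\<^sup>2 \<le> R\<^sup>2 * (1 + 1 / real d)\<^sup>2 * (1 + 1 / real d)\<^sup>2"
    and "0 < g" "g \<le> 1"
  shows "vol d (ball2 d c x) powr (1 / real d)
     \<le> vol d (ball2 d c' R) powr (1 / real d) * (1 + 3 * (real d powr (- 1 / 2) / g))"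
proof -
  let ?F = "1 + 1 / real d"
  have "x\<^sup>2 \<le> (R * ?F\<^sup>2)\<^sup>2" using assms(4) by (simp add: power2_eq_square algebra_simps)
  then have x: "x \<le> R * ?F\<^sup>2" by (rule power2_le_imp_le) (use assms in simp)
  have "(1 / real d)\<^sup>2 \<le> 1 / real d"
    using assms(1) by (simp add: power2_eq_square field_simps)
  \<comment> \<open>The constant 3 comes from \<open>2 / d + 1 / d\<^sup>2\<close>, with the last
    term at most \<open>1 / d\<close>.\<close>
  then have "?F\<^sup>2 \<le> 1 + 3 * (1 / real d)" by (simp add: power2_sum)
  also have "\<dots> \<le> 1 + 3 * (real d powr (- 1 / 2) / g)"
  proof -
    have "1 / real d \<le> real d powr (- 1 / 2) / 1" using powr_minus_half_ge assms by simp
    also have "\<dots> \<le> real d powr (- 1 / 2) / g" using assms by (intro divide_left_mono) auto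
    finally show ?thesis by simp
  qed
  finally have F: "?F\<^sup>2 \<le> 1 + 3 * (real d powr (- 1 / 2) / g)" .
  have "x \<le> R * (1 + 3 * (real d powr (- 1 / 2) / g))"
    using x mult_left_mono[OF F assms(2)] by linarith
  then have "unit_ball_vol (real d) powr (1 / real d) * x
      \<le> unit_ball_vol (real d) powr (1 / real d) * (R * (1 + 3 * (real d powr (- 1 / 2) / g)))"
    by (intro mult_left_mono) auto
  then show ?thesis
    using assms by (simp add: vol_ball2_root mult.assoc)
qed

text \<open>The search is exhaustive, so the volume bound only needs one good pair: a centre from
  \<open>near_center_exists\<close> and the point of \<open>Ystar\<close> farthest from it.\<close>

lemma algorithm_prog_correct:
  assumes d: "d \<ge> 1" and Y: "Y \<subseteq> Rd d" and n: "card Y = n" and ys: "set ys = Y" "distinct ys"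
    and \<delta>: "0 \<le> \<delta>" "\<delta> \<le> 1" and \<gamma>: "0 \<le> \<gamma>" "\<gamma> \<le> 1"
    and Ystar: "Ystar \<subseteq> Y" "real (card Ystar) \<ge> \<delta> * real n" "Ystar \<subseteq> ball2 d cstar Rstar"
  shows "\<exists>t. exec algorithm_prog (input_store d ys \<delta> \<gamma>) t \<and>
    real (card (output_ellipsoid d t \<inter> Y)) \<ge> \<delta> * (1 - \<gamma>) * real n \<and>
    (\<gamma> * \<delta> > 0 \<longrightarrow> vol d (output_ellipsoid d t) powr (1 / real d)
       \<le> vol d (ball2 d cstar Rstar) powr (1 / real d) * (1 + 3 * (real d powr (- 1 / 2) / (\<gamma> * \<delta>))))"
proof -
  define R0 where "R0 = snd (input_store d ys \<delta> \<gamma>)"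
  define N0 where "N0 = fst (input_store d ys \<delta> \<gamma>)"
  define M where "M = node_count n (d * d + d)"
  let ?F = "1 + 1 / real d"
  have len: "length ys = n" using ys n distinct_card by metis
  have N0: "N0 0 = d" "N0 1 = n" by (simp_all add: N0_def input_store_def len)
  have "input_store d ys \<delta> \<gamma> = (N0, R0)" by (simp add: N0_def R0_def)
  moreover obtain N' R' R1 q b x found where "exec algorithm_prog (N0, R0) (N', R')"
    and tree: "tree_upto d n R0 (M * n * d) R1"
    and found: "if found then q < M \<and> 0 \<le> b \<and> admissible d n R1 q b else b = 0"
    and best: "\<forall>q<M. \<forall>j<n. admissible d n R1 q (sqdist d (node d R1 q) (node d R1 j)) \<longrightarrow>
        found \<and> b \<le> sqdist d (node d R1 q) (node d R1 j)"
    and x: "0 \<le> x" "b \<le> x\<^sup>2" "x\<^sup>2 \<le> b * ?F\<^sup>2"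
    and centre: "found \<longrightarrow> (\<forall>i<d. R' i = node d R1 q i)"
    and matrix: "\<forall>i<d. \<forall>j<d. R' (d + i * d + j) = (if i = j then x else 0)"
    using run_algorithm[OF N0 d, of R0] unfolding run_def M_def[symmetric] Let_def
    by (elim exE conjE) (rule that; assumption)
  ultimately have exec: "exec algorithm_prog (input_store d ys \<delta> \<gamma>) (N', R')" by simp
  define c where "c = (\<lambda>i\<in>{..<d}. R' i)"
  have E: "output_ellipsoid d (N', R') = ball2 d c x"
    using matrix x(1) unfolding output_ellipsoid_def c_def by (intro trans[OF ellipsoid_scalar]) auto
  have node: "node d R1 l i = (ys ! l) i" if "l < n" "i < d" for l i
    using tree_upto_input(2)[of d ys \<delta> \<gamma>] tree that unfolding R0_def len by blast
  have R1: "n > 0 \<Longrightarrow> R1 0 = \<delta>"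
    using tree_upto_input(1)[of d ys \<delta> \<gamma>] tree unfolding R0_def len by blast
  have ysl: "ys ! l \<in> Y" if "l < n" for l using that len ys by auto
  have inj: "inj_on ((!) ys) {..<n}" using ys(2) len by (auto simp: inj_on_def nth_eq_iff_index_eq)
  have finY: "finite Y" using ys by auto
  have M: "n \<le> M" by (simp add: M_def le_node_count)
  \<comment> \<open>Around centre 0, the distance to the farthest point covers everything, which is
    admissible because \<open>\<delta> \<le> 1\<close>.\<close>
  have nonempty: found if "n > 0"
  proof -
    let ?D = "\<lambda>l. sqdist d (node d R1 0) (node d R1 l)"
    have "Max (?D ` {..<n}) \<in> ?D ` {..<n}" using that by (intro Max_in) auto
    then obtain j where j: "j < n" "?D j = Max (?D ` {..<n})" by force
    then have "covered d n R1 0 (?D j) = {..<n}" by (auto simp: covered_def)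
    then have "admissible d n R1 0 (?D j)"
      using R1[OF that] \<delta> by (simp add: admissible_def mult_left_le_one_le)
    then show ?thesis using best j(1) M that by auto
  qed
  have card: "real (card (output_ellipsoid d (N', R') \<inter> Y)) \<ge> \<delta> * (1 - \<gamma>) * real n"
  proof (cases "n = 0")
    case False
    then have f: found using nonempty by simp
    have "(!) ys ` covered d n R1 q b \<subseteq> ball2 d c x \<inter> Y"
    proof
      fix y assume "y \<in> (!) ys ` covered d n R1 q b"
      then obtain l where l: "l < n" "sqdist d (node d R1 q) (node d R1 l) \<le> b" "y = ys ! l"
        by (auto simp: covered_def)
      have "sqdist d c y = sqdist d (node d R1 q) (node d R1 l)"
        using l centre f node by (intro sqdist_cong) (auto simp: c_def)
      then show "y \<in> ball2 d c x \<inter> Y"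
        using l x ysl Y by (subst Int_iff, subst in_ball2_iff) auto
    qed
    then have "card ((!) ys ` covered d n R1 q b) \<le> card (ball2 d c x \<inter> Y)"
      using finY by (intro card_mono) auto
    moreover have "card ((!) ys ` covered d n R1 q b) = card (covered d n R1 q b)"
      by (intro card_image inj_on_subset[OF inj]) (auto simp: covered_def)
    moreover have "\<delta> * real n \<le> real (card (covered d n R1 q b))"
      using found f R1 False by (simp add: admissible_def)
    moreover have "\<delta> * (1 - \<gamma>) * real n \<le> \<delta> * 1 * real n"
      using \<delta> \<gamma> by (intro mult_right_mono mult_left_mono) auto
    ultimately show ?thesis unfolding E by linarith
  qed simp
  have volume: "vol d (output_ellipsoid d (N', R')) powr (1 / real d)
       \<le> vol d (ball2 d cstar Rstar) powr (1 / real d) * (1 + 3 * (real d powr (- 1 / 2) / (\<gamma> * \<delta>)))"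
    if pos: "\<gamma> * \<delta> > 0"
  proof (cases "n = 0")
    case True
    then have "M = 0" by (simp add: M_def node_count_0)
    \<comment> \<open>Without points the output has radius 0 and volume 0, so the bound holds even
      for negative \<open>Rstar\<close>.\<close>
    then have "b = 0" using found by (simp split: if_splits)
    then have "x = 0" using x by simp
    then show ?thesis using d pos unfolding E by (simp add: vol_ball2_root)
  next
    case False
    then have n0: "n > 0" by simp
    \<comment> \<open>Positivity of \<open>\<delta>\<close> makes \<open>Ystar\<close> nonempty,
      which in turn yields \<open>Rstar \<ge> 0\<close>.\<close>
    have "\<delta> > 0" using pos \<delta> \<gamma> by (simp add: zero_less_mult_iff)
    then have "\<delta> * real n > 0" using n0 by simp
    then have "Ystar \<noteq> {}" using Ystar(2) by auto
    then obtain y where "y \<in> ball2 d cstar Rstar" using Ystar by auto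
    then have R: "Rstar \<ge> 0"
      using order.trans[OF L2_set_nonneg] by (auto simp: ball2_def)
    define J where "J = {l. l < n \<and> ys ! l \<in> Ystar}"
    have J: "(!) ys ` J = Ystar"
      using ys Ystar(1) len by (auto simp: J_def in_set_conv_nth image_iff) (metis in_set_conv_nth subsetD)
    have J0: "J \<subseteq> {..<n}" "J \<noteq> {}" using J \<open>Ystar \<noteq> {}\<close> by (auto simp: J_def)
    have cardJ: "card J = card Ystar"
      using card_image[OF inj_on_subset[OF inj J0(1)]] J by simp
    have near: "sqdist d (node d R1 j) cstar \<le> Rstar\<^sup>2" if "j \<in> J" for j
    proof -
      have "ys ! j \<in> ball2 d cstar Rstar" using J Ystar that by auto
      moreover have "ys ! j \<in> Rd d" using that Y ysl by (auto simp: J_def)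
      ultimately have "sqdist d cstar (ys ! j) \<le> Rstar\<^sup>2" using R in_ball2_iff by blast
      moreover have "sqdist d (node d R1 j) cstar = sqdist d (ys ! j) cstar"
        using that by (intro sqdist_cong) (auto simp: J_def node)
      ultimately show ?thesis by (simp add: sqdist_commute)
    qed
    have grow: "node d R1 (n + (p * n + j)) i
        = node d R1 j i + real d / (real d + 1) * (node d R1 p i - node d R1 j i)"
      if "p < node_count n (d * d + d)" "j < n" "i < d" for p j i
      using tree_upto_node[OF tree] that by (simp add: M_def)
    have "\<exists>p < node_count n (d * d + d). \<forall>j\<in>J.
        sqdist d (node d R1 p) (node d R1 j) \<le> Rstar\<^sup>2 * ?F\<^sup>2"
      by (rule near_center_exists[OF d J0 zero_le_power2 near grow])
    then obtain p where p: "p < M" "\<forall>j\<in>J. sqdist d (node d R1 p) (node d R1 j) \<le> Rstar\<^sup>2 * ?F\<^sup>2"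
      unfolding M_def by blast
    let ?D = "\<lambda>l. sqdist d (node d R1 p) (node d R1 l)"
    have finJ: "finite J" by (simp add: J_def)
    \<comment> \<open>The farthest point of \<open>J\<close> supplies a radius that the search has
      tried.\<close>
    have "Max (?D ` J) \<in> ?D ` J" using J0 finJ by (intro Max_in) auto
    then obtain j where j: "j \<in> J" "?D j = Max (?D ` J)" by force
    have "J \<subseteq> covered d n R1 p (?D j)"
      using j finJ by (auto simp: covered_def J_def)
    then have "card J \<le> card (covered d n R1 p (?D j))"
      by (intro card_mono) (auto simp: covered_def)
    then have "admissible d n R1 p (?D j)"
      using Ystar(2) cardJ R1[OF n0] by (simp add: admissible_def)
    then have "b \<le> ?D j" using best p(1) j(1) J0 by auto
    also have "\<dots> \<le> Rstar\<^sup>2 * ?F\<^sup>2" using p j by blast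
    finally have "b * ?F\<^sup>2 \<le> Rstar\<^sup>2 * ?F\<^sup>2 * ?F\<^sup>2" by (intro mult_right_mono) auto
    then have "x\<^sup>2 \<le> Rstar\<^sup>2 * ?F\<^sup>2 * ?F\<^sup>2" using x by linarith
    then show ?thesis
      unfolding E using d R x pos \<gamma> \<delta> by (intro output_volume) (auto simp: mult_le_one)
  qed
  show ?thesis
    by (rule exI[of _ "(N', R')"]) (intro conjI impI exec card volume)
qed

theorem theorem2p2:
  "\<exists>(algorithm :: com) (C :: real) (\<epsilon> :: nat \<Rightarrow> real).
     C > 0 \<and> \<epsilon> \<longlonglongrightarrow> 0 \<and>
     (\<forall>(d :: nat) (n :: nat) (Y :: (nat \<Rightarrow> real) set) (ys :: (nat \<Rightarrow> real) list)
        (\<delta> :: real) (\<gamma> :: real) (Ystar :: (nat \<Rightarrow> real) set) (cstar :: nat \<Rightarrow> real) (Rstar :: real).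
        d \<ge> 1 \<longrightarrow> Y \<subseteq> Rd d \<longrightarrow> finite Y \<longrightarrow> card Y = n \<longrightarrow> set ys = Y \<longrightarrow> distinct ys \<longrightarrow>
        0 \<le> \<delta> \<longrightarrow> \<delta> \<le> 1 \<longrightarrow> 0 \<le> \<gamma> \<longrightarrow> \<gamma> \<le> 1 \<longrightarrow>
        Ystar \<subseteq> Y \<longrightarrow> real (card Ystar) \<ge> \<delta> * real n \<longrightarrow>
        cstar \<in> Rd d \<longrightarrow> Ystar \<subseteq> ball2 d cstar Rstar \<longrightarrow>
        (\<exists>t E. exec algorithm (input_store d ys \<delta> \<gamma>) t \<and> E = output_ellipsoid d t \<and>
           real (card (E \<inter> Y)) \<ge> \<delta> * (1 - \<gamma>) * real n \<and>
           (\<gamma> * \<delta> > 0 \<longrightarrow>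
              vol d E powr (1 / real d)
                \<le> vol d (ball2 d cstar Rstar) powr (1 / real d)
                    * (1 + C * (real d powr (- 1 / 2 + \<epsilon> d) / (\<gamma> * \<delta>))))))"
\<comment> \<open>The relative error \<open>3 / d\<close> is already below the required order, so
  the correction to the exponent can be 0.\<close>
proof (intro exI[of _ algorithm_prog] exI[of _ 3] exI[of _ "\<lambda>_. 0"] conjI allI impI, goal_cases)
  case (3 d n Y ys \<delta> \<gamma> Ystar cstar Rstar)
  then show ?case
    using algorithm_prog_correct[of d Y n ys \<delta> \<gamma> Ystar cstar Rstar] by simp
qed simp_all

end
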